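(* The problem Min-ICR-Exact is solvable in polynomial time when restricted to inputs $(I,\succ_{M,W},\mu)$ in which one side of the market has fully known strict preference orderings, i.e., $p_a$ is a strict total order on $a$'s acceptable candidates in $I$ for every agent $a$ on that side.
   Context: SMPI. An instance $I=(M,W,p_{M,W})$ of SMPI (Stable Marriage with Partially ordered preferences and Incomplete lists) consists of $n$ men $M$, $n$ women $W$, a set of mutually acceptable (man, woman) pairs, and for each agent $a\in M\cup W$ a strict partial order $p_a$ on the set of $a$'s acceptable candidates (agents of the opposite side). $(c_1,c_2)\in p_a$ means $a$ strictly prefers $c_1$ to $c_2$; $a$ cannot compare distinct $c_1,c_2$ if neither $(c_1,c_2)$ nor $(c_2,c_1)$ is in $p_a$. Every agent strictly prefers each acceptable candidate to being unmatched. Refinement. An instance $I'$ (same agents and acceptable pairs, with relations $p'_a$) refines $I$ if for each agent $a$ every strict total order that is a linear extension of $p'_a$ is a linear extension of $p_a$. A strict preference profile $\succ_{M,W}=(\succ_a)_{a\in M\cup W}$ (each $\succ_a$ a strict total order on $a$'s acceptable candidates) refines $I$ iff $p_a\subseteq\ \succ_a$ for all $a$. Interviews. An interview is a mutually acceptable pair $(m,w)$; it is informative to both. Carrying out a set $T$ of interviews on $I$ yields an instance $I'$ exactly the same as $I$ except that each agent $a$ now strictly orders the candidates he/she interviewed: writing $T(a)$ for the candidates interviewed by $a$, $p'_a=p_a\cup L_a$, where $L_a$ is a strict total order on $T(a)$ and $p'_a$ is acyclic; no other pairs are added (in particular, no comparisons are inferred by transitivity, and $p'_a$ is used as it stands in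 the definitions below). Such an $I'$ is an interview-compatible refinement of $I$, and its cost (given $I$) is the minimum $|T|$ over sets $T$ of interviews that refine $I$ into $I'$. Stability. A matching $\mu$ is a set of mutually acceptable pairs in which each agent appears at most once. $\mu$ is weakly stable if no acceptable pair $(m,w)\notin\mu$ is such that each of $m,w$ is unmatched or strictly prefers the other to his/her partner. A very weak blocking pair is an acceptable pair $(m,w)\notin\mu$ such that each of $m,w$ is unmatched, or strictly prefers the other to his/her partner, or cannot compare the other with his/her partner. $\mu$ is super-stable if it has no very weak blocking pair. Min-ICR-Exact. Input: $(I,\succ_{M,W},\mu)$ with $I$ an SMPI instance, $\succ_{M,W}$ a strict preference profile refining $I$, and $\mu$ a matching weakly stable w.r.t. $\succ_{M,W}$. Task: find an interview-compatible refinement $I'$ of $I$ such that (i) $\succ_{M,W}$ refines $I'$, (ii) $\mu$ is super-stable in $I'$, and (iii) $I'$ has minimum cost among interview-compatible refinements of $I$ satisfying (i) and (ii). *)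

theory Defs
  imports Complex_Main "HOL-Computational_Algebra.Polynomial"
begin

section \<open>Stable marriage with partially ordered preferences and incomplete lists\<close>

text \<open>
  The \<open>n\<close> men and the \<open>n\<close> women are both numbered \<open>0, ..., n - 1\<close>. A set of (man, woman) pairs
  \<open>S\<close> (acceptable pairs, interviews, or a matching) assigns to every agent the set \<open>partners S a\<close>
  of agents of the opposite side paired with it; the side is implicit in \<open>a\<close>.
\<close>

datatype agent = Man nat | Woman nat

fun partners :: "(nat \<times> nat) set \<Rightarrow> agent \<Rightarrow> nat set" where
  "partners S (Man m) = {w. (m, w) \<in> S}"
| "partners S (Woman w) = {m. (m, w) \<in> S}"

text \<open>\<open>(c, d) \<in> P a\<close> means that \<open>a\<close> strictly prefers \<open>c\<close> to \<open>d\<close>.\<close>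

type_synonym profile = "agent \<Rightarrow> (nat \<times> nat) set"

record smpi =
  num :: nat
  acc :: "(nat \<times> nat) set"
  pref :: profile

definition strict_partial_order_on :: "nat set \<Rightarrow> (nat \<times> nat) set \<Rightarrow> bool" where
  "strict_partial_order_on C r \<longleftrightarrow> r \<subseteq> C \<times> C \<and> irrefl r \<and> trans r"

definition strict_total_order_on :: "nat set \<Rightarrow> (nat \<times> nat) set \<Rightarrow> bool" where
  "strict_total_order_on C r \<longleftrightarrow> strict_partial_order_on C r \<and> total_on C r"

definition smpi_instance :: "smpi \<Rightarrow> bool" where
  "smpi_instance I \<longleftrightarrow> acc I \<subseteq> {..<num I} \<times> {..<num I}
     \<and> (\<forall>a. strict_partial_order_on (partners (acc I) a) (pref I a))"

definition strict_profile :: "smpi \<Rightarrow> profile \<Rightarrow> bool" where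
  "strict_profile I P \<longleftrightarrow> (\<forall>a. strict_total_order_on (partners (acc I) a) (P a))"

definition profile_refines :: "profile \<Rightarrow> smpi \<Rightarrow> bool" where
  "profile_refines P I \<longleftrightarrow> (\<forall>a. pref I a \<subseteq> P a)"

definition refines :: "smpi \<Rightarrow> smpi \<Rightarrow> bool" where
  "refines I' I \<longleftrightarrow> num I' = num I \<and> acc I' = acc I \<and>
     (\<forall>a r. strict_total_order_on (partners (acc I) a) r \<and> pref I' a \<subseteq> r \<longrightarrow> pref I a \<subseteq> r)"


section \<open>Interviews\<close>

text \<open>
  \<open>interview_result I T I'\<close>: carrying out the interviews \<open>T\<close> on \<open>I\<close> can yield \<open>I'\<close>. The relations
  of \<open>I'\<close> are not transitively closed, so \<open>I'\<close> need not satisfy \<open>smpi_instance\<close>.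
\<close>

definition interview_result :: "smpi \<Rightarrow> (nat \<times> nat) set \<Rightarrow> smpi \<Rightarrow> bool" where
  "interview_result I T I' \<longleftrightarrow> T \<subseteq> acc I \<and> num I' = num I \<and> acc I' = acc I \<and>
     (\<forall>a. \<exists>L. strict_total_order_on (partners T a) L
              \<and> pref I' a = pref I a \<union> L \<and> acyclic (pref I' a))"

definition interview_compatible_refinement :: "smpi \<Rightarrow> smpi \<Rightarrow> bool" where
  "interview_compatible_refinement I I' \<longleftrightarrow> (\<exists>T. interview_result I T I')"

definition interview_cost :: "smpi \<Rightarrow> smpi \<Rightarrow> nat" where
  "interview_cost I I' = (LEAST k. \<exists>T. interview_result I T I' \<and> card T = k)"

lemma interview_compatible_refinement_refines:
  "interview_compatible_refinement I I' \<Longrightarrow> refines I' I"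
proof -
  assume "interview_compatible_refinement I I'"
  then obtain T where T: "interview_result I T I'"
    unfolding interview_compatible_refinement_def ..
  have "pref I a \<subseteq> pref I' a" for a
  proof -
    from T obtain L where "pref I' a = pref I a \<union> L"
      unfolding interview_result_def by metis
    then show ?thesis by simp
  qed
  moreover from T have "num I' = num I" "acc I' = acc I"
    by (simp_all add: interview_result_def)
  ultimately show ?thesis unfolding refines_def by (meson order_trans)
qed


section \<open>Stability\<close>

definition matching :: "smpi \<Rightarrow> (nat \<times> nat) set \<Rightarrow> bool" where
  "matching I \<mu> \<longleftrightarrow> \<mu> \<subseteq> acc I \<and>
     (\<forall>a. \<forall>c \<in> partners \<mu> a. \<forall>d \<in> partners \<mu> a. c = d)"

definition incomparable :: "profile \<Rightarrow> agent \<Rightarrow> nat \<Rightarrow> nat \<Rightarrow> bool" where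
  "incomparable P a c d \<longleftrightarrow> c \<noteq> d \<and> (c, d) \<notin> P a \<and> (d, c) \<notin> P a"

definition strictly_willing :: "profile \<Rightarrow> (nat \<times> nat) set \<Rightarrow> agent \<Rightarrow> nat \<Rightarrow> bool" where
  "strictly_willing P \<mu> a c \<longleftrightarrow> partners \<mu> a = {} \<or> (\<exists>d \<in> partners \<mu> a. (c, d) \<in> P a)"

definition possibly_willing :: "profile \<Rightarrow> (nat \<times> nat) set \<Rightarrow> agent \<Rightarrow> nat \<Rightarrow> bool" where
  "possibly_willing P \<mu> a c \<longleftrightarrow> partners \<mu> a = {} \<or>
     (\<exists>d \<in> partners \<mu> a. (c, d) \<in> P a \<or> incomparable P a c d)"

definition weakly_stable :: "smpi \<Rightarrow> (nat \<times> nat) set \<Rightarrow> bool" where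
  "weakly_stable I \<mu> \<longleftrightarrow> matching I \<mu> \<and>
     \<not> (\<exists>m w. (m, w) \<in> acc I - \<mu>
          \<and> strictly_willing (pref I) \<mu> (Man m) w \<and> strictly_willing (pref I) \<mu> (Woman w) m)"

definition very_weak_blocking_pair :: "smpi \<Rightarrow> (nat \<times> nat) set \<Rightarrow> nat \<Rightarrow> nat \<Rightarrow> bool" where
  "very_weak_blocking_pair I \<mu> m w \<longleftrightarrow> (m, w) \<in> acc I - \<mu>
     \<and> possibly_willing (pref I) \<mu> (Man m) w \<and> possibly_willing (pref I) \<mu> (Woman w) m"

definition super_stable :: "smpi \<Rightarrow> (nat \<times> nat) set \<Rightarrow> bool" where
  "super_stable I \<mu> \<longleftrightarrow> matching I \<mu> \<and> \<not> (\<exists>m w. very_weak_blocking_pair I \<mu> m w)"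


section \<open>The problem Min-ICR-Exact\<close>

type_synonym icr_input = "smpi \<times> profile \<times> (nat \<times> nat) set"

fun min_icr_exact_input :: "icr_input \<Rightarrow> bool" where
  "min_icr_exact_input (I, P, \<mu>) \<longleftrightarrow>
     smpi_instance I \<and> strict_profile I P \<and> profile_refines P I
     \<and> weakly_stable (I\<lparr>pref := P\<rparr>) \<mu>"

fun icr_exact_feasible :: "icr_input \<Rightarrow> smpi \<Rightarrow> bool" where
  "icr_exact_feasible (I, P, \<mu>) I' \<longleftrightarrow>
     interview_compatible_refinement I I' \<and> profile_refines P I' \<and> super_stable I' \<mu>"

fun min_icr_exact_solution :: "icr_input \<Rightarrow> smpi \<Rightarrow> bool" where
  "min_icr_exact_solution (I, P, \<mu>) I' \<longleftrightarrow> icr_exact_feasible (I, P, \<mu>) I' \<and>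
     (\<forall>J. icr_exact_feasible (I, P, \<mu>) J \<longrightarrow> interview_cost I I' \<le> interview_cost I J)"

definition men_fully_known :: "smpi \<Rightarrow> bool" where
  "men_fully_known I \<longleftrightarrow>
     (\<forall>m < num I. strict_total_order_on (partners (acc I) (Man m)) (pref I (Man m)))"

definition women_fully_known :: "smpi \<Rightarrow> bool" where
  "women_fully_known I \<longleftrightarrow>
     (\<forall>w < num I. strict_total_order_on (partners (acc I) (Woman w)) (pref I (Woman w)))"

fun one_side_fully_known :: "icr_input \<Rightarrow> bool" where
  "one_side_fully_known (I, P, \<mu>) \<longleftrightarrow> men_fully_known I \<or> women_fully_known I"


section \<open>Polynomial time\<close>

text \<open>
  The model of computation is Jones's language WHILE over binary trees (N. D. Jones,
  \<open>Computability and Complexity from a Programming Perspective\<close>), whose polynomial-time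
  decidable problems are those of Turing machines. Instead of unit cost, evaluating an
  expression costs one unit per operation plus the full size of every variable read. This rules
  out building exponentially large trees by repeated \<open>X := cons X X\<close> in polynomial time, and makes
  a step-by-step simulation by a Turing machine on serialised trees polynomial.
\<close>

datatype val = Atom | Pair val val

datatype exp = V nat | NilE | ConsE exp exp | HdE exp | TlE exp

datatype com =
    Assign nat exp
  | Seq com com
  | If exp com com
  | While exp com

type_synonym state = "nat \<Rightarrow> val"

fun hd_val :: "val \<Rightarrow> val" where
  "hd_val Atom = Atom"
| "hd_val (Pair x y) = x"

fun tl_val :: "val \<Rightarrow> val" where
  "tl_val Atom = Atom"
| "tl_val (Pair x y) = y"

fun exp_val :: "exp \<Rightarrow> state \<Rightarrow> val" where
  "exp_val (V x) s = s x"
| "exp_val NilE s = Atom"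
| "exp_val (ConsE e f) s = Pair (exp_val e s) (exp_val f s)"
| "exp_val (HdE e) s = hd_val (exp_val e s)"
| "exp_val (TlE e) s = tl_val (exp_val e s)"

text \<open>For a tree, \<open>size\<close> is the number of its \<open>Pair\<close> nodes.\<close>

fun exp_cost :: "exp \<Rightarrow> state \<Rightarrow> nat" where
  "exp_cost (V x) s = 1 + size (s x)"
| "exp_cost NilE s = 1"
| "exp_cost (ConsE e f) s = 1 + exp_cost e s + exp_cost f s"
| "exp_cost (HdE e) s = 1 + exp_cost e s"
| "exp_cost (TlE e) s = 1 + exp_cost e s"

text \<open>\<open>exec c s t s'\<close>: started in \<open>s\<close>, program \<open>c\<close> terminates in \<open>s'\<close> at cost \<open>t\<close>.
  A test succeeds iff its value is not \<open>Atom\<close>.\<close>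

inductive exec :: "com \<Rightarrow> state \<Rightarrow> nat \<Rightarrow> state \<Rightarrow> bool" where
  Assign: "exec (Assign x e) s (1 + exp_cost e s) (s(x := exp_val e s))"
| Seq: "exec c s t s' \<Longrightarrow> exec d s' u s'' \<Longrightarrow> exec (Seq c d) s (t + u) s''"
| IfTrue: "exp_val e s \<noteq> Atom \<Longrightarrow> exec c s t s' \<Longrightarrow> exec (If e c d) s (1 + exp_cost e s + t) s'"
| IfFalse: "exp_val e s = Atom \<Longrightarrow> exec d s t s' \<Longrightarrow> exec (If e c d) s (1 + exp_cost e s + t) s'"
| WhileFalse: "exp_val e s = Atom \<Longrightarrow> exec (While e c) s (1 + exp_cost e s) s"
| WhileTrue: "exp_val e s \<noteq> Atom \<Longrightarrow> exec c s t s' \<Longrightarrow> exec (While e c) s' u s'' \<Longrightarrow>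
    exec (While e c) s (1 + exp_cost e s + t + u) s''"

inductive_cases exec_AssignE: "exec (Assign x e) s t s'"
inductive_cases exec_SeqE: "exec (Seq c d) s t s'"
inductive_cases exec_IfE: "exec (If e c d) s t s'"
inductive_cases exec_WhileE: "exec (While e c) s t s'"

lemma exec_deterministic:
  "exec c s t s' \<Longrightarrow> exec c s u s'' \<Longrightarrow> t = u \<and> s' = s''"
proof (induction arbitrary: u s'' rule: exec.induct)
  case (Assign x e s)
  then show ?case by (auto elim: exec_AssignE)
next
  case (Seq c s t s' d v s2)
  from Seq.prems obtain t1 u1 s1 where "u = t1 + u1" "exec c s t1 s1" "exec d s1 u1 s''"
    by (rule exec_SeqE)
  with Seq.IH show ?case by metis
next
  case (IfTrue e s c t s' d)
  from IfTrue.prems IfTrue.hyps(1) obtain t1 where "u = 1 + exp_cost e s + t1" "exec c s t1 s''"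
    by (elim exec_IfE) simp_all
  with IfTrue.IH show ?case by metis
next
  case (IfFalse e s d t s' c)
  from IfFalse.prems IfFalse.hyps(1) obtain t1 where "u = 1 + exp_cost e s + t1" "exec d s t1 s''"
    by (elim exec_IfE) simp_all
  with IfFalse.IH show ?case by metis
next
  case (WhileFalse e s c)
  from WhileFalse.prems show ?case
    by (cases rule: exec.cases) (use WhileFalse.hyps in blast)+
next
  case (WhileTrue e s c t s' v s2)
  from WhileTrue.prems obtain t1 u1 s1
    where "u = 1 + exp_cost e s + t1 + u1" "exec c s t1 s1" "exec (While e c) s1 u1 s''"
    by (cases rule: exec.cases) (use WhileTrue.hyps(1) in blast)+
  with WhileTrue.IH show ?case by metis
qed

lemma size_exp_val_less_exp_cost: "size (exp_val e s) < exp_cost e s"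
proof (induction e)
  case (HdE e)
  then show ?case by (cases "exp_val e s") auto
next
  case (TlE e)
  then show ?case by (cases "exp_val e s") auto
qed auto

text \<open>Programs read their input from variable 0 and leave their output there.\<close>

definition init_state :: "val \<Rightarrow> state" where
  "init_state v = (\<lambda>x. if x = 0 then v else Atom)"

text \<open>
  A search problem is given by encodings of its inputs and outputs, its set of admissible inputs
  and the relation between inputs and their solutions.
\<close>

definition poly_time_solvable ::
  "('x \<Rightarrow> val) \<Rightarrow> ('y \<Rightarrow> val) \<Rightarrow> 'x set \<Rightarrow> ('x \<Rightarrow> 'y \<Rightarrow> bool) \<Rightarrow> bool" where
  "poly_time_solvable enc_in enc_out D R \<longleftrightarrow>
     (\<exists>(c :: com) (p :: nat poly). \<forall>x \<in> D. \<exists>y t s.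
        exec c (init_state (enc_in x)) t s \<and> t \<le> poly p (size (enc_in x))
        \<and> s 0 = enc_out y \<and> R x y)"


section \<open>Encoding of inputs and outputs\<close>

text \<open>
  Relations on \<open>{0, ..., n - 1}\<close> are encoded as their Boolean \<open>n\<close> by \<open>n\<close> matrices, so an instance
  with \<open>n\<close> men and \<open>n\<close> women has an encoding of size between \<open>n\<close> and a polynomial in \<open>n\<close>.
\<close>

definition enc_bool :: "bool \<Rightarrow> val" where
  "enc_bool b = (if b then Pair Atom Atom else Atom)"

definition enc_list :: "('a \<Rightarrow> val) \<Rightarrow> 'a list \<Rightarrow> val" where
  "enc_list f xs = foldr (\<lambda>x v. Pair (f x) v) xs Atom"

definition enc_rel :: "nat \<Rightarrow> (nat \<times> nat) set \<Rightarrow> val" where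
  "enc_rel n r = enc_list (\<lambda>i. enc_list (\<lambda>j. enc_bool ((i, j) \<in> r)) [0..<n]) [0..<n]"

definition enc_profile :: "nat \<Rightarrow> profile \<Rightarrow> val" where
  "enc_profile n P = Pair (enc_list (\<lambda>m. enc_rel n (P (Man m))) [0..<n])
                          (enc_list (\<lambda>w. enc_rel n (P (Woman w))) [0..<n])"

definition enc_smpi :: "smpi \<Rightarrow> val" where
  "enc_smpi I = Pair (enc_rel (num I) (acc I)) (enc_profile (num I) (pref I))"

fun enc_input :: "icr_input \<Rightarrow> val" where
  "enc_input (I, P, \<mu>) = Pair (enc_smpi I) (Pair (enc_profile (num I) P) (enc_rel (num I) \<mu>))"

text \<open>
  The encodings lose no information: in every instance and every interview-compatible refinement
  all relations live on the agents \<open>0, ..., n - 1\<close>, and agents out of this range have empty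
  relations.
\<close>

definition in_range :: "nat \<Rightarrow> profile \<Rightarrow> bool" where
  "in_range n P \<longleftrightarrow> (\<forall>a. P a \<subseteq> {..<n} \<times> {..<n}) \<and>
     (\<forall>i \<ge> n. P (Man i) = {} \<and> P (Woman i) = {})"

lemma enc_list_eq_iff: "enc_list f xs = enc_list g ys \<longleftrightarrow> map f xs = map g ys"
proof (induction xs arbitrary: ys)
  case Nil
  then show ?case by (cases ys) (auto simp: enc_list_def)
next
  case (Cons x xs)
  then show ?case by (cases ys) (auto simp: enc_list_def)
qed

lemma enc_list_upt_eqD:
  assumes "enc_list f [0..<n] = enc_list g [0..<m]"
  shows "n = m" and "\<And>i. i < n \<Longrightarrow> f i = g i"
proof -
  from assms have *: "map f [0..<n] = map g [0..<m]" by (simp add: enc_list_eq_iff)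
  from arg_cong[OF this, of length] show "n = m" by simp
  with * show "\<And>i. i < n \<Longrightarrow> f i = g i" by simp
qed

lemma enc_rel_eqD:
  assumes "enc_rel n r = enc_rel m q"
  shows "n = m" and "r \<inter> {..<n} \<times> {..<n} = q \<inter> {..<n} \<times> {..<n}"
proof -
  note * = enc_list_upt_eqD[OF assms[unfolded enc_rel_def]]
  show "n = m" by (fact *(1))
  have "(i, j) \<in> r \<longleftrightarrow> (i, j) \<in> q" if "i < n" "j < n" for i j
    using enc_list_upt_eqD(2)[OF *(2)[OF that(1)] that(2)] by (simp add: enc_bool_def split: if_splits)
  then show "r \<inter> {..<n} \<times> {..<n} = q \<inter> {..<n} \<times> {..<n}" by auto
qed

lemma enc_profile_eqD:
  assumes "enc_profile n P = enc_profile n Q" "in_range n P" "in_range n Q"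
  shows "P = Q"
proof
  fix a
  have sub: "P a \<subseteq> {..<n} \<times> {..<n}" "Q a \<subseteq> {..<n} \<times> {..<n}"
    using assms(2,3) unfolding in_range_def by blast+
  have eqs: "enc_list (\<lambda>m. enc_rel n (P (Man m))) [0..<n] = enc_list (\<lambda>m. enc_rel n (Q (Man m))) [0..<n]"
    "enc_list (\<lambda>w. enc_rel n (P (Woman w))) [0..<n] = enc_list (\<lambda>w. enc_rel n (Q (Woman w))) [0..<n]"
    using assms(1) by (simp_all add: enc_profile_def)
  show "P a = Q a"
  proof (cases a)
    case (Man i)
    show ?thesis
    proof (cases "i < n")
      case True
      from enc_rel_eqD(2)[OF enc_list_upt_eqD(2)[OF eqs(1) True]] sub Man show ?thesis
        by (simp add: Int_absorb2)
    next
      case False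
      with assms(2,3) Man show ?thesis by (simp add: in_range_def)
    qed
  next
    case (Woman i)
    show ?thesis
    proof (cases "i < n")
      case True
      from enc_rel_eqD(2)[OF enc_list_upt_eqD(2)[OF eqs(2) True]] sub Woman show ?thesis
        by (simp add: Int_absorb2)
    next
      case False
      with assms(2,3) Woman show ?thesis by (simp add: in_range_def)
    qed
  qed
qed

lemma enc_smpi_inj:
  fixes I J :: smpi
  assumes "enc_smpi I = enc_smpi J"
    and "acc I \<subseteq> {..<num I} \<times> {..<num I}" "in_range (num I) (pref I)"
    and "acc J \<subseteq> {..<num J} \<times> {..<num J}" "in_range (num J) (pref J)"
  shows "I = J"
proof -
  have *: "enc_rel (num I) (acc I) = enc_rel (num J) (acc J)"
    "enc_profile (num I) (pref I) = enc_profile (num J) (pref J)"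
    using assms(1) by (simp_all add: enc_smpi_def)
  have n: "num I = num J" using enc_rel_eqD(1)[OF *(1)] .
  have "acc I = acc J" using enc_rel_eqD(2)[OF *(1)] assms(2,4) n by (simp add: Int_absorb2)
  moreover have "pref I = pref J" using enc_profile_eqD *(2) assms(3,5) n by metis
  ultimately show ?thesis using n by simp
qed

lemma in_rangeI:
  assumes "A \<subseteq> {..<n} \<times> {..<n}" and P: "\<And>a. P a \<subseteq> partners A a \<times> partners A a"
  shows "in_range n P"
proof -
  have "partners A a \<subseteq> {..<n}" for a using assms(1) by (cases a) auto
  with P have "P a \<subseteq> {..<n} \<times> {..<n}" for a by (meson Sigma_mono order_trans)
  moreover have "P (Man i) = {} \<and> P (Woman i) = {}" if "i \<ge> n" for i
  proof -
    have "partners A (Man i) = {}" "partners A (Woman i) = {}" using assms(1) that by auto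
    then show ?thesis using P[of "Man i"] P[of "Woman i"] by simp
  qed
  ultimately show ?thesis unfolding in_range_def by simp
qed

lemma smpi_instance_in_range:
  assumes "smpi_instance I"
  shows "in_range (num I) (pref I)"
proof (rule in_rangeI)
  show "acc I \<subseteq> {..<num I} \<times> {..<num I}"
    using assms unfolding smpi_instance_def by (rule conjunct1)
  show "pref I a \<subseteq> partners (acc I) a \<times> partners (acc I) a" for a
    using assms unfolding smpi_instance_def strict_partial_order_on_def by blast
qed

lemma interview_compatible_refinement_in_range:
  assumes "smpi_instance I" "interview_compatible_refinement I I'"
  shows "acc I' \<subseteq> {..<num I'} \<times> {..<num I'}" "in_range (num I') (pref I')"
proof -
  from assms(2) obtain T where T: "interview_result I T I'"
    unfolding interview_compatible_refinement_def ..
  then have eq: "num I' = num I" "acc I' = acc I" and sub: "T \<subseteq> acc I"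
    unfolding interview_result_def by blast+
  have "acc I \<subseteq> {..<num I} \<times> {..<num I}"
    using assms(1) unfolding smpi_instance_def by (rule conjunct1)
  then show A: "acc I' \<subseteq> {..<num I'} \<times> {..<num I'}" unfolding eq .
  have P: "pref I' a \<subseteq> partners (acc I') a \<times> partners (acc I') a" for a
  proof -
    from T obtain L where L: "strict_total_order_on (partners T a) L" and p: "pref I' a = pref I a \<union> L"
      unfolding interview_result_def by metis
    from L have "L \<subseteq> partners T a \<times> partners T a"
      unfolding strict_total_order_on_def strict_partial_order_on_def by blast
    moreover have "partners T a \<subseteq> partners (acc I) a" using sub by (cases a) auto
    ultimately have "L \<subseteq> partners (acc I) a \<times> partners (acc I) a" by blast
    moreover have "pref I a \<subseteq> partners (acc I) a \<times> partners (acc I) a"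
      using assms(1) unfolding smpi_instance_def strict_partial_order_on_def by blast
    ultimately show ?thesis unfolding p eq by (rule Un_least[rotated])
  qed
  show "in_range (num I') (pref I')" by (rule in_rangeI[OF A P])
qed

end

theory Submission
  imports Defs
begin

text \<open>
  A very weak blocking pair \<open>(m, w)\<close> of \<open>I\<close> can only be resolved by comparing \<open>w\<close> with the partner
  of \<open>m\<close>, or \<open>m\<close> with the partner of \<open>w\<close>. As comparisons are not inferred by transitivity, this
  needs the interview \<open>(m, w)\<close> and the interview of the agent making the comparison with his or her
  partner. When one side is fully known, that agent is on the other side, so these interviews are
  all forced, and together they suffice because \<open>\<mu>\<close> is stable under the true preferences. The set
  of forced interviews is definable by quantifiers bounded by \<open>n\<close> without testing which side is
  known, and hence computable in polynomial time.
\<close>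

section \<open>Polynomial-time functions on trees\<close>

lemma poly_nat_mono:
  fixes p :: "nat poly"
  shows "m \<le> n \<Longrightarrow> poly p m \<le> poly p n"
  by (induction p) (auto intro!: add_mono mult_mono)

text \<open>An assigned value is smaller than the cost of its expression, so a variable grows by at
  most the time spent. Time bounds therefore also bound the sizes of intermediate results.\<close>

lemma exec_size: "exec c s t s' \<Longrightarrow> size (s' x) \<le> size (s x) + t"
proof (induction rule: exec.induct)
  case (Assign y e s)
  then show ?case using size_exp_val_less_exp_cost[of e s] by auto
qed auto

section \<open>Programs as transformations of two variables\<close>

definition regs :: "state \<Rightarrow> val \<times> val" where
  "regs s = (s 0, s 1)"

definition rsize :: "val \<times> val \<Rightarrow> nat" where
  "rsize r = size (fst r) + size (snd r)"

text \<open>Every state is allowed as a start, not only an initial one, so that a program can run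
  after another one whatever the remaining variables contain.\<close>

definition poly_time_regs :: "(val \<times> val \<Rightarrow> val \<times> val) \<Rightarrow> bool" where
  "poly_time_regs F \<longleftrightarrow> (\<exists>c (p :: nat poly). \<forall>s. \<exists>t s'.
     exec c s t s' \<and> regs s' = F (regs s) \<and> t \<le> poly p (rsize (regs s)))"

lemma poly_time_regsI:
  assumes "\<And>s. \<exists>t s'. exec c s t s' \<and> regs s' = F (regs s) \<and> t \<le> poly p (rsize (regs s))"
  shows "poly_time_regs F"
  using assms unfolding poly_time_regs_def by blast

lemma poly_time_regs_comp:
  assumes "poly_time_regs F" "poly_time_regs G"
  shows "poly_time_regs (\<lambda>r. G (F r))"
proof -
  from assms obtain c p d q where
    c: "\<And>s. \<exists>t s'. exec c s t s' \<and> regs s' = F (regs s) \<and> t \<le> poly p (rsize (regs s))" and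
    d: "\<And>s. \<exists>t s'. exec d s t s' \<and> regs s' = G (regs s) \<and> t \<le> poly q (rsize (regs s))"
    unfolding poly_time_regs_def by metis
  \<comment> \<open>The first program can enlarge each of the two variables by its running time,
    hence the factor 2 in the argument of \<open>q\<close>.\<close>
  let ?p = "p + pcompose q ([:0, 1:] + smult 2 p)"
  have "\<exists>t s'. exec (Seq c d) s t s' \<and> regs s' = G (F (regs s)) \<and> t \<le> poly ?p (rsize (regs s))" for s
  proof -
    from c obtain t s1 where 1: "exec c s t s1" "regs s1 = F (regs s)" "t \<le> poly p (rsize (regs s))"
      by blast
    from d obtain u s2 where 2: "exec d s1 u s2" "regs s2 = G (regs s1)" "u \<le> poly q (rsize (regs s1))"
      by blast
    have "rsize (regs s1) \<le> rsize (regs s) + 2 * poly p (rsize (regs s))"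
      using exec_size[OF 1(1), of 0] exec_size[OF 1(1), of 1] 1(3) by (simp add: rsize_def regs_def)
    then have "u \<le> poly q (rsize (regs s) + 2 * poly p (rsize (regs s)))"
      using 2(3) poly_nat_mono le_trans by blast
    with 1(3) have "t + u \<le> poly ?p (rsize (regs s))" by (simp add: poly_pcompose)
    then show ?thesis using exec.Seq[OF 1(1) 2(1)] 1(2) 2(2) by metis
  qed
  then show ?thesis unfolding poly_time_regs_def by blast
qed

lemma poly_time_regs_assign:
  assumes e: "\<And>s. exp_val e s = h (regs s)"
    and cost: "\<And>s. exp_cost e s \<le> k * (1 + rsize (regs s))"
  shows "poly_time_regs (\<lambda>r. (h r, snd r))" "poly_time_regs (\<lambda>r. (fst r, h r))"
proof -
  have le: "1 + exp_cost e s \<le> poly [:1 + k, k:] (rsize (regs s))" for s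
    using cost[of s] by (simp add: algebra_simps)
  have *: "\<exists>t s'. exec (Assign x e) s t s' \<and> regs s' = regs (s(x := h (regs s)))
      \<and> t \<le> poly [:1 + k, k:] (rsize (regs s))" for x s
    using exec.Assign[of x e s] le[of s] e by metis
  show "poly_time_regs (\<lambda>r. (h r, snd r))"
    by (rule poly_time_regsI[of "Assign 0 e" _ "[:1 + k, k:]"]) (use *[of 0] in \<open>simp add: regs_def\<close>)
  show "poly_time_regs (\<lambda>r. (fst r, h r))"
    by (rule poly_time_regsI[of "Assign 1 e" _ "[:1 + k, k:]"]) (use *[of 1] in \<open>simp add: regs_def\<close>)
qed

text \<open>Variable 0 carries the argument and the value, variable 1 a stack that is restored.\<close>

definition poly_time :: "(val \<Rightarrow> val) \<Rightarrow> bool" where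
  "poly_time f \<longleftrightarrow> poly_time_regs (\<lambda>r. (f (fst r), snd r))"

lemma poly_timeE:
  assumes "poly_time f"
  obtains c p where "\<And>s. \<exists>t s'. exec c s t s' \<and> s' 0 = f (s 0) \<and> s' 1 = s 1
    \<and> t \<le> poly p (size (s 0) + size (s 1))"
  using assms unfolding poly_time_def poly_time_regs_def regs_def rsize_def by auto

lemma poly_time_comp: "poly_time f \<Longrightarrow> poly_time g \<Longrightarrow> poly_time (\<lambda>v. f (g v))"
  unfolding poly_time_def using poly_time_regs_comp[of "\<lambda>r. (g (fst r), snd r)" "\<lambda>r. (f (fst r), snd r)"]
  by simp

text \<open>Started with an empty stack, the program has a time bound in \<open>size v\<close>
  alone, and its output cannot outgrow input plus time.\<close>

lemma poly_time_size:
  assumes "poly_time f"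
  shows "\<exists>q. \<forall>v. size (f v) \<le> poly q (size v)"
proof -
  from assms obtain c p where c: "\<And>s. \<exists>t s'. exec c s t s' \<and> s' 0 = f (s 0) \<and> s' 1 = s 1
    \<and> t \<le> poly p (size (s 0) + size (s 1))" by (rule poly_timeE) blast
  have "size (f v) \<le> poly ([:0, 1:] + p) (size v)" for v
  proof -
    from c[of "init_state v"] obtain t s' where
      "exec c (init_state v) t s'" "s' 0 = f v" "t \<le> poly p (size v)"
      by (auto simp: init_state_def)
    with exec_size[of c "init_state v" t s' 0] show ?thesis by (simp add: init_state_def)
  qed
  then show ?thesis by blast
qed

section \<open>Projections, pairs, branches and loops\<close>

lemma poly_time_id: "poly_time (\<lambda>v. v)"
  unfolding poly_time_def
  by (rule poly_time_regs_assign(1)[of "V 0" _ 1]) (auto simp: regs_def rsize_def)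

lemma poly_time_Atom: "poly_time (\<lambda>v. Atom)"
  unfolding poly_time_def
  by (rule poly_time_regs_assign(1)[of "NilE" _ 1]) (auto simp: regs_def rsize_def)

lemma poly_time_hd: "poly_time f \<Longrightarrow> poly_time (\<lambda>v. hd_val (f v))"
proof (rule poly_time_comp[of hd_val])
  show "poly_time hd_val"
    unfolding poly_time_def
    by (rule poly_time_regs_assign(1)[of "HdE (V 0)" _ 2]) (auto simp: regs_def rsize_def)
qed

lemma poly_time_tl: "poly_time f \<Longrightarrow> poly_time (\<lambda>v. tl_val (f v))"
proof (rule poly_time_comp[of tl_val])
  show "poly_time tl_val"
    unfolding poly_time_def
    by (rule poly_time_regs_assign(1)[of "TlE (V 0)" _ 2]) (auto simp: regs_def rsize_def)
qed

text \<open>The stack saves the argument while \<open>f\<close> runs, then the value of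
  \<open>f\<close> is pushed, the argument is reloaded from below it and its copy deleted. After
  \<open>g\<close> has run, the saved value is joined to the result and popped.\<close>

lemma poly_time_Pair:
  assumes "poly_time f" "poly_time g"
  shows "poly_time (\<lambda>v. Pair (f v) (g v))"
proof -
  have push: "poly_time_regs (\<lambda>r. (fst r, Pair (fst r) (snd r)))"
    by (rule poly_time_regs_assign(2)[of "ConsE (V 0) (V 1)" _ 3]) (auto simp: regs_def rsize_def)
  have second: "poly_time_regs (\<lambda>r. (hd_val (tl_val (snd r)), snd r))"
    by (rule poly_time_regs_assign(1)[of "HdE (TlE (V 1))" _ 3]) (auto simp: regs_def rsize_def)
  have drop: "poly_time_regs (\<lambda>r. (fst r, Pair (hd_val (snd r)) (tl_val (tl_val (snd r)))))"
    by (rule poly_time_regs_assign(2)[of "ConsE (HdE (V 1)) (TlE (TlE (V 1)))" _ 6])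
      (auto simp: regs_def rsize_def)
  have cons: "poly_time_regs (\<lambda>r. (Pair (hd_val (snd r)) (fst r), snd r))"
    by (rule poly_time_regs_assign(1)[of "ConsE (HdE (V 1)) (V 0)" _ 4]) (auto simp: regs_def rsize_def)
  have pop: "poly_time_regs (\<lambda>r. (fst r, tl_val (snd r)))"
    by (rule poly_time_regs_assign(2)[of "TlE (V 1)" _ 2]) (auto simp: regs_def rsize_def)
  note f = assms(1)[unfolded poly_time_def] and g = assms(2)[unfolded poly_time_def]
  from poly_time_regs_comp[OF poly_time_regs_comp[OF poly_time_regs_comp[OF poly_time_regs_comp[OF
      poly_time_regs_comp[OF poly_time_regs_comp[OF poly_time_regs_comp[OF push f] push] second] drop]
      g] cons] pop]
  show ?thesis unfolding poly_time_def by simp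
qed

text \<open>The test value is paired with the argument: the program branches on the head, and each
  branch works on the tail, so the argument survives the evaluation of \<open>b\<close>.\<close>

lemma poly_time_If:
  assumes b: "poly_time b" and f: "poly_time f" and g: "poly_time g"
  shows "poly_time (\<lambda>v. if b v \<noteq> Atom then f v else g v)"
proof -
  let ?h = "\<lambda>x. if hd_val x \<noteq> Atom then f (tl_val x) else g (tl_val x)"
  have "poly_time (\<lambda>x. f (tl_val x))" "poly_time (\<lambda>x. g (tl_val x))"
    using poly_time_comp f g poly_time_tl[OF poly_time_id] by blast+
  then obtain c p d q where
    c: "\<And>s. \<exists>t s'. exec c s t s' \<and> s' 0 = f (tl_val (s 0)) \<and> s' 1 = s 1
      \<and> t \<le> poly p (size (s 0) + size (s 1))" and
    d: "\<And>s. \<exists>t s'. exec d s t s' \<and> s' 0 = g (tl_val (s 0)) \<and> s' 1 = s 1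
      \<and> t \<le> poly q (size (s 0) + size (s 1))"
    by (elim poly_timeE) blast
  \<comment> \<open>The test costs \<open>2 + size (s 0)\<close> and the branching one more
    unit.\<close>
  let ?p = "p + q + [:3, 1:]"
  have "\<exists>t s'. exec (If (HdE (V 0)) c d) s t s' \<and> regs s' = (?h (s 0), s 1)
      \<and> t \<le> poly ?p (rsize (regs s))" for s
  proof (cases "hd_val (s 0) = Atom")
    case True
    from d[of s] obtain t s' where d': "exec d s t s'" "s' 0 = g (tl_val (s 0))" "s' 1 = s 1"
      "t \<le> poly q (size (s 0) + size (s 1))" by blast
    have "exec (If (HdE (V 0)) c d) s (1 + exp_cost (HdE (V 0)) s + t) s'"
      by (rule exec.IfFalse) (use True d' in auto)
    moreover have "1 + exp_cost (HdE (V 0)) s + t \<le> poly ?p (rsize (regs s))"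
      using d'(4) by (simp add: rsize_def regs_def)
    moreover have "regs s' = (?h (s 0), s 1)" using True d' by (simp add: regs_def)
    ultimately show ?thesis by blast
  next
    case False
    from c[of s] obtain t s' where c': "exec c s t s'" "s' 0 = f (tl_val (s 0))" "s' 1 = s 1"
      "t \<le> poly p (size (s 0) + size (s 1))" by blast
    have "exec (If (HdE (V 0)) c d) s (1 + exp_cost (HdE (V 0)) s + t) s'"
      by (rule exec.IfTrue) (use False c' in auto)
    moreover have "1 + exp_cost (HdE (V 0)) s + t \<le> poly ?p (rsize (regs s))"
      using c'(4) by (simp add: rsize_def regs_def)
    moreover have "regs s' = (?h (s 0), s 1)" using False c' by (simp add: regs_def)
    ultimately show ?thesis by blast
  qed
  then have "poly_time ?h"
    unfolding poly_time_def by (intro poly_time_regsI[of _ _ ?p]) (simp only: regs_def fst_conv snd_conv)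
  from poly_time_comp[OF this poly_time_Pair[OF b poly_time_id]] show ?thesis by (simp cong: if_cong)
qed

text \<open>The loop state carries its counter at \<open>tl_val (hd_val _)\<close>, and the loop
  runs until the counter is used up, after \<open>k v\<close> rounds. Iterating a polynomial-time
  body may blow up exponentially, so \<open>bound\<close> controls all intermediate states.\<close>

lemma poly_time_loop:
  assumes B: "poly_time B" and h: "poly_time h"
    and steps: "\<And>v. k v \<le> poly q (size v)"
    and continue: "\<And>v i. i < k v \<Longrightarrow> tl_val (hd_val ((B ^^ i) (h v))) \<noteq> Atom"
    and stop: "\<And>v. tl_val (hd_val ((B ^^ k v) (h v))) = Atom"
    and bound: "\<And>v i. i \<le> k v \<Longrightarrow> size ((B ^^ i) (h v)) \<le> poly q (size v)"
  shows "poly_time (\<lambda>v. (B ^^ k v) (h v))"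
proof -
  from B obtain c p where c: "\<And>s. \<exists>t s'. exec c s t s' \<and> s' 0 = B (s 0) \<and> s' 1 = s 1
      \<and> t \<le> poly p (size (s 0) + size (s 1))" by (rule poly_timeE) blast
  from h obtain d r where d: "\<And>s. \<exists>t s'. exec d s t s' \<and> s' 0 = h (s 0) \<and> s' 1 = s 1
      \<and> t \<le> poly r (size (s 0) + size (s 1))" by (rule poly_timeE) blast
  let ?e = "TlE (HdE (V 0))"
  let ?w = "While ?e c"
  \<comment> \<open>Here \<open>j\<close> is the number of rounds still to run; the factor
    \<open>j + 1\<close> includes the final failing test, and 4 is the cost of a test apart from the
    size of the loop state.\<close>
  have loop: "\<exists>t s'. exec ?w s t s' \<and> s' 0 = (B ^^ k v) (h v) \<and> s' 1 = s 1
      \<and> t \<le> (j + 1) * (4 + poly q (size v) + poly p (poly q (size v) + size (s 1)))"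
    if "j \<le> k v" "s 0 = (B ^^ (k v - j)) (h v)" for j v s
    using that
  proof (induction j arbitrary: s)
    case 0
    have "exec ?w s (1 + exp_cost ?e s) s"
      by (rule exec.WhileFalse) (use 0 stop in simp)
    moreover have "1 + exp_cost ?e s \<le> 4 + poly q (size v)" using bound[of "k v" v] 0 by simp
    ultimately show ?case using 0 by (intro exI[of _ "1 + exp_cost ?e s"] exI[of _ s]) auto
  next
    case (Suc j)
    let ?N = "4 + poly q (size v) + poly p (poly q (size v) + size (s 1))"
    have i: "k v - j = Suc (k v - Suc j)" "k v - Suc j < k v" using Suc.prems(1) by auto
    from c[of s] obtain t s1 where t: "exec c s t s1" "s1 0 = B (s 0)" "s1 1 = s 1"
      "t \<le> poly p (size (s 0) + size (s 1))" by blast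
    have "s1 0 = (B ^^ (k v - j)) (h v)" using t(2) Suc.prems(2) i(1) by simp
    with Suc.IH[of s1] Suc.prems(1) t(3) obtain u s2 where u: "exec ?w s1 u s2"
      "s2 0 = (B ^^ k v) (h v)" "s2 1 = s 1" "u \<le> (j + 1) * ?N" by auto
    have b: "size (s 0) \<le> poly q (size v)" using bound[of "k v - Suc j" v] Suc.prems(2) by simp
    have "t \<le> poly p (poly q (size v) + size (s 1))"
      using t(4) poly_nat_mono[of "size (s 0) + size (s 1)" "poly q (size v) + size (s 1)" p] b by simp
    then have "1 + exp_cost ?e s + t + u \<le> (Suc j + 1) * ?N" using u(4) b by simp
    moreover have "exec ?w s (1 + exp_cost ?e s + t + u) s2"
      by (rule exec.WhileTrue[OF _ t(1) u(1)]) (use continue[OF i(2)] Suc.prems(2) in simp)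
    ultimately show ?case using u by blast
  qed
  let ?p = "r + (q + 1) * ([:4:] + q + pcompose p (q + [:0, 1:]))"
  have "\<exists>t s'. exec (Seq d ?w) s t s' \<and> regs s' = ((B ^^ k (s 0)) (h (s 0)), s 1)
      \<and> t \<le> poly ?p (rsize (regs s))" for s
  proof -
    let ?n = "size (s 0)" and ?m = "size (s 0) + size (s 1)"
    from d[of s] obtain t s1 where t: "exec d s t s1" "s1 0 = h (s 0)" "s1 1 = s 1" "t \<le> poly r ?m"
      by blast
    from loop[of "k (s 0)" "s 0" s1] t(2,3) obtain u s2 where u: "exec ?w s1 u s2"
      "s2 0 = (B ^^ k (s 0)) (h (s 0))" "s2 1 = s 1"
      "u \<le> (k (s 0) + 1) * (4 + poly q ?n + poly p (poly q ?n + size (s 1)))" by auto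
    have q: "poly q ?n \<le> poly q ?m" by (rule poly_nat_mono) simp
    have k: "k (s 0) \<le> poly q ?m" using steps[of "s 0"] q by simp
    have p: "poly p (poly q ?n + size (s 1)) \<le> poly p (poly q ?m + ?m)"
      by (rule poly_nat_mono) (use q in simp)
    note u(4)
    also have "(k (s 0) + 1) * (4 + poly q ?n + poly p (poly q ?n + size (s 1)))
        \<le> (poly q ?m + 1) * (4 + poly q ?m + poly p (poly q ?m + ?m))"
      using k p q by (intro mult_le_mono) simp_all
    finally have "t + u \<le> poly ?p (rsize (regs s))"
      using t(4) by (simp add: poly_pcompose rsize_def regs_def)
    then show ?thesis using exec.Seq[OF t(1) u(1)] u(2,3) by (auto simp: regs_def)
  qed
  then show ?thesis
    unfolding poly_time_def by (intro poly_time_regsI[of _ _ ?p]) (simp only: regs_def fst_conv snd_conv)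
qed


section \<open>Bounded recursion and quantification over indices\<close>

text \<open>Indices are represented in unary: \<open>v\<close> stands for the length of its right spine.\<close>

fun len :: "val \<Rightarrow> nat" where
  "len Atom = 0"
| "len (Pair x y) = Suc (len y)"

lemma len_le_size: "len v \<le> size v"
  by (induction v) auto

lemma len_enc_list [simp]: "len (enc_list f xs) = length xs"
  by (induction xs) (auto simp: enc_list_def)

lemma len_tl_funpow: "len ((tl_val ^^ i) v) = len v - i"
proof (induction i)
  case (Suc i)
  then show ?case by (cases "(tl_val ^^ i) v") auto
qed simp

lemma size_tl_funpow: "size ((tl_val ^^ i) v) \<le> size v"
proof (induction i)
  case (Suc i)
  then show ?case by (cases "(tl_val ^^ i) v") auto
qed simp

lemma Atom_iff_len: "v = Atom \<longleftrightarrow> len v = 0"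
  by (cases v) auto

text \<open>The loop state is the argument with a counter, paired with the accumulator. The counter
  is a suffix of \<open>g v\<close> that loses one cell per round, so the indices come in decreasing
  order, which is the order in which \<open>foldr\<close> consumes an ascending list.\<close>

lemma poly_time_foldr:
  assumes F: "poly_time (\<lambda>p. F (hd_val (hd_val p)) (len (tl_val (hd_val p))) (tl_val p))"
    and g: "poly_time g" and a: "poly_time a"
    and bound: "\<And>v k. k \<le> len (g v) \<Longrightarrow> size (foldr (F v) [k..<len (g v)] (a v)) \<le> poly q (size v)"
  shows "poly_time (\<lambda>v. foldr (F v) [0..<len (g v)] (a v))"
proof -
  let ?y = "\<lambda>x. Pair (Pair (hd_val (hd_val x)) (tl_val (tl_val (hd_val x)))) (tl_val x)"
  \<comment> \<open>The counter is shortened before \<open>F\<close> reads it, so the first round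
    sees the index \<open>len (g v) - 1\<close> and the last one 0.\<close>
  let ?B = "\<lambda>x. Pair (Pair (hd_val (hd_val x)) (tl_val (tl_val (hd_val x))))
    (F (hd_val (hd_val x)) (len (tl_val (tl_val (hd_val x)))) (tl_val x))"
  let ?h = "\<lambda>v. Pair (Pair v (g v)) (a v)"
  have y: "poly_time ?y"
    by (intro poly_time_Pair poly_time_hd poly_time_tl poly_time_id)
  have "poly_time (\<lambda>x. F (hd_val (hd_val x)) (len (tl_val (tl_val (hd_val x)))) (tl_val x))"
    using poly_time_comp[OF F y] by simp
  then have B: "poly_time ?B"
    by (intro poly_time_Pair poly_time_hd poly_time_tl poly_time_id)
  have h: "poly_time ?h" by (intro poly_time_Pair g a poly_time_id)
  have iter: "(?B ^^ i) (?h v)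
      = Pair (Pair v ((tl_val ^^ i) (g v))) (foldr (F v) [len (g v) - i..<len (g v)] (a v))"
    if "i \<le> len (g v)" for i v
    using that
  proof (induction i)
    case (Suc i)
    then have "[len (g v) - Suc i..<len (g v)]
        = (len (g v) - Suc i) # [len (g v) - i..<len (g v)]"
      by (subst upt_conv_Cons) (auto simp: Suc_diff_Suc)
    moreover have "len (tl_val ((tl_val ^^ i) (g v))) = len (g v) - Suc i"
      using len_tl_funpow[of "Suc i" "g v"] by simp
    ultimately show ?case using Suc by simp
  qed simp
  from g obtain r where r: "\<And>v. size (g v) \<le> poly r (size v)" using poly_time_size by blast
  have "poly_time (\<lambda>v. (?B ^^ len (g v)) (?h v))"
  \<comment> \<open>The summand 2 accounts for the two \<open>Pair\<close> nodes that hold the loop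
    state together; \<open>r\<close> bounds the counter and \<open>q\<close> the
    accumulator.\<close>
  proof (rule poly_time_loop[OF B h, of _ "[:2, 1:] + r + q"])
    show "len (g v) \<le> poly ([:2, 1:] + r + q) (size v)" for v
      using len_le_size[of "g v"] r[of v] by simp
    show "tl_val (hd_val ((?B ^^ i) (?h v))) \<noteq> Atom" if "i < len (g v)" for v i
      using that iter[of i v] by (simp add: Atom_iff_len len_tl_funpow)
    show "tl_val (hd_val ((?B ^^ len (g v)) (?h v))) = Atom" for v
      using iter[of "len (g v)" v] by (simp add: Atom_iff_len len_tl_funpow)
    show "size ((?B ^^ i) (?h v)) \<le> poly ([:2, 1:] + r + q) (size v)" if "i \<le> len (g v)" for v i
      using that iter[of i v] bound[of "len (g v) - i" v] size_tl_funpow[of i "g v"] r[of v] by simp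
  qed
  from poly_time_tl[OF this] show ?thesis by (simp add: iter)
qed

text \<open>The size condition of the fold holds automatically: each element is a polynomial-time
  value of the argument and a unary index, and there are at most \<open>len (g v)\<close>
  elements.\<close>

lemma poly_time_enc_list:
  assumes f: "poly_time (\<lambda>p. f (hd_val p) (len (tl_val p)))" and g: "poly_time g"
  shows "poly_time (\<lambda>v. enc_list (f v) [0..<len (g v)])"
proof -
  let ?F = "\<lambda>v i. Pair (f v i)"
  have fold: "foldr (?F v) xs Atom = enc_list (f v) xs" for v xs
    by (simp add: enc_list_def)
  from f obtain q where q: "\<And>p. size (f (hd_val p) (len (tl_val p))) \<le> poly q (size p)"
    using poly_time_size by blast
  from g obtain r where r: "\<And>v. size (g v) \<le> poly r (size v)" using poly_time_size by blast
  let ?Q = "pcompose q ([:1, 1:] + r)"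
  have elem: "size (f v i) \<le> poly ?Q (size v)" if "i \<le> len (g v)" for v i
  proof -
    \<comment> \<open>The suffix of \<open>g v\<close> of length \<open>i\<close> is a unary code of
      \<open>i\<close> no larger than \<open>g v\<close>.\<close>
    let ?c = "(tl_val ^^ (len (g v) - i)) (g v)"
    have "size ?c \<le> poly r (size v)" using size_tl_funpow r le_trans by blast
    then have "poly q (size (Pair v ?c)) \<le> poly ?Q (size v)"
      by (simp add: poly_pcompose add.commute poly_nat_mono)
    with q[of "Pair v ?c"] that show ?thesis by (simp add: len_tl_funpow)
  qed
  have total: "size (enc_list (f v) xs) \<le> length xs * (1 + poly ?Q (size v))"
    if "\<forall>i\<in>set xs. i \<le> len (g v)" for v xs
    using that
  proof (induction xs)
    case (Cons i xs)
    then show ?case using elem[of i v] by (simp add: enc_list_def)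
  qed (simp add: enc_list_def)
  have "poly_time (\<lambda>v. foldr (?F v) [0..<len (g v)] Atom)"
  proof (rule poly_time_foldr[OF _ g poly_time_Atom, of _ "r * (1 + ?Q)"])
    have "poly_time (\<lambda>p. f (hd_val (hd_val p)) (len (tl_val (hd_val p))))"
      using poly_time_comp[OF f poly_time_hd[OF poly_time_id]] .
    then show "poly_time (\<lambda>p. Pair (f (hd_val (hd_val p)) (len (tl_val (hd_val p)))) (tl_val p))"
      by (intro poly_time_Pair poly_time_tl poly_time_id)
    fix v k assume "k \<le> len (g v)"
    have "size (enc_list (f v) [k..<len (g v)]) \<le> (len (g v) - k) * (1 + poly ?Q (size v))"
      using total[of "[k..<len (g v)]" v] by simp
    also have "\<dots> \<le> poly r (size v) * (1 + poly ?Q (size v))"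
      by (rule mult_right_mono) (use r[of v] len_le_size[of "g v"] in auto)
    finally show "size (foldr (?F v) [k..<len (g v)] Atom) \<le> poly (r * (1 + ?Q)) (size v)"
      unfolding fold by simp
  qed
  then show ?thesis unfolding fold .
qed

definition nth_val :: "val \<Rightarrow> nat \<Rightarrow> val" where
  "nth_val v i = hd_val ((tl_val ^^ i) v)"

lemma nth_val_enc_list [simp]: "i < length xs \<Longrightarrow> nth_val (enc_list f xs) i = f (xs ! i)"
proof (induction xs arbitrary: i)
  case (Cons x xs)
  then show ?case
    by (cases i) (auto simp: nth_val_def enc_list_def funpow_Suc_right simp del: funpow.simps)
qed simp

text \<open>A fold that ignores its index iterates \<open>tl_val\<close>, and its accumulators never
  exceed the size of \<open>f v\<close>.\<close>

lemma poly_time_nth_val: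
  assumes f: "poly_time f" and g: "poly_time g"
  shows "poly_time (\<lambda>v. nth_val (f v) (len (g v)))"
proof -
  have fold: "foldr (\<lambda>i. tl_val) xs v = (tl_val ^^ length xs) v" for xs :: "nat list" and v
    by (induction xs) auto
  from f obtain q where q: "\<And>v. size (f v) \<le> poly q (size v)" using poly_time_size by blast
  have "poly_time (\<lambda>v. foldr (\<lambda>i. tl_val) [0..<len (g v)] (f v))"
  proof (rule poly_time_foldr[OF _ g f])
    show "poly_time (\<lambda>p. tl_val (tl_val p))" by (intro poly_time_tl poly_time_id)
    show "size (foldr (\<lambda>i. tl_val) [k..<len (g v)] (f v)) \<le> poly q (size v)" for v k
      unfolding fold using size_tl_funpow q le_trans by blast
  qed
  from poly_time_hd[OF this] show ?thesis by (simp add: fold nth_val_def)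
qed

section \<open>Decidable predicates and bounded quantifiers\<close>

definition poly_time_pred :: "(val \<Rightarrow> bool) \<Rightarrow> bool" where
  "poly_time_pred Q \<longleftrightarrow> poly_time (\<lambda>v. enc_bool (Q v))"

lemma poly_time_enc_bool: "poly_time_pred Q \<Longrightarrow> poly_time (\<lambda>v. enc_bool (Q v))"
  by (simp add: poly_time_pred_def)

lemma poly_time_pred_if:
  "poly_time f \<Longrightarrow> poly_time_pred Q \<Longrightarrow> poly_time_pred R \<Longrightarrow>
   poly_time_pred (\<lambda>v. if f v \<noteq> Atom then Q v else R v)"
  unfolding poly_time_pred_def
  using poly_time_If[of f "\<lambda>v. enc_bool (Q v)" "\<lambda>v. enc_bool (R v)"]
  by (simp add: if_distrib[of enc_bool])

lemma enc_bool_noteq_Atom [simp]: "enc_bool b \<noteq> Atom \<longleftrightarrow> b" "enc_bool b = Atom \<longleftrightarrow> \<not> b"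
  by (simp_all add: enc_bool_def)

lemma poly_time_pred_const: "poly_time_pred (\<lambda>v. b)"
  unfolding poly_time_pred_def enc_bool_def
  by (cases b) (auto intro: poly_time_Pair poly_time_Atom)

lemma poly_time_pred_noteq_Atom: "poly_time f \<Longrightarrow> poly_time_pred (\<lambda>v. f v \<noteq> Atom)"
  using poly_time_pred_if[OF _ poly_time_pred_const[of True] poly_time_pred_const[of False], of f]
  by (simp add: if_bool_eq_conj)

lemma poly_time_pred_not: "poly_time_pred Q \<Longrightarrow> poly_time_pred (\<lambda>v. \<not> Q v)"
  using poly_time_pred_if[OF poly_time_enc_bool poly_time_pred_const[of False] poly_time_pred_const[of True], of Q]
  by (simp add: if_bool_eq_conj)

lemma poly_time_pred_conj:
  "poly_time_pred Q \<Longrightarrow> poly_time_pred R \<Longrightarrow> poly_time_pred (\<lambda>v. Q v \<and> R v)"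
  using poly_time_pred_if[OF poly_time_enc_bool _ poly_time_pred_const[of False], of Q R]
  by (simp cong: conj_cong if_cong) (simp add: if_bool_eq_conj conj_commute cong: conj_cong)

lemma poly_time_pred_disj:
  assumes "poly_time_pred Q" "poly_time_pred R"
  shows "poly_time_pred (\<lambda>v. Q v \<or> R v)"
  using poly_time_pred_not[OF poly_time_pred_conj[OF assms[THEN poly_time_pred_not]]] by simp

text \<open>The search is a fold with a Boolean accumulator, which never exceeds size 1. The
  predicate receives the bound index in unary, paired with the argument, so quantifiers can be
  nested.\<close>

lemma poly_time_pred_ex:
  assumes Q: "poly_time_pred (\<lambda>p. Q (hd_val p) (len (tl_val p)))" and g: "poly_time g"
  shows "poly_time_pred (\<lambda>v. \<exists>i < len (g v). Q v i)"
proof -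
  let ?F = "\<lambda>v i a. if enc_bool (Q v i) \<noteq> Atom then Pair Atom Atom else a"
  have fold: "foldr (?F v) xs Atom = enc_bool (\<exists>i\<in>set xs. Q v i)" for v xs
    by (induction xs) (auto simp: enc_bool_def)
  have "poly_time (\<lambda>v. foldr (?F v) [0..<len (g v)] Atom)"
  proof (rule poly_time_foldr[OF _ g poly_time_Atom])
    have "poly_time (\<lambda>p. enc_bool (Q (hd_val (hd_val p)) (len (tl_val (hd_val p)))))"
      using poly_time_comp[OF poly_time_enc_bool[OF Q] poly_time_hd[OF poly_time_id]] .
    then show "poly_time (\<lambda>p. if enc_bool (Q (hd_val (hd_val p)) (len (tl_val (hd_val p)))) \<noteq> Atom
        then Pair Atom Atom else tl_val p)"
      by (intro poly_time_If poly_time_Pair poly_time_Atom poly_time_tl poly_time_id)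
    show "size (foldr (?F v) [k..<len (g v)] Atom) \<le> poly 1 (size v)" for v k
      unfolding fold by (simp add: enc_bool_def)
  qed
  then show ?thesis
    unfolding fold poly_time_pred_def by (simp add: atLeast0LessThan Bex_def)
qed

lemma poly_time_solvableI:
  assumes f: "poly_time f" and R: "\<And>x. x \<in> D \<Longrightarrow> \<exists>y. f (enc_in x) = enc_out y \<and> R x y"
  shows "poly_time_solvable enc_in enc_out D R"
proof -
  from f obtain c p where c: "\<And>s. \<exists>t s'. exec c s t s' \<and> s' 0 = f (s 0) \<and> s' 1 = s 1
    \<and> t \<le> poly p (size (s 0) + size (s 1))" by (rule poly_timeE) blast
  have "\<exists>y t s. exec c (init_state (enc_in x)) t s \<and> t \<le> poly p (size (enc_in x))
      \<and> s 0 = enc_out y \<and> R x y" if "x \<in> D" for x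
  proof -
    from c[of "init_state (enc_in x)"] obtain t s where "exec c (init_state (enc_in x)) t s"
      "s 0 = f (enc_in x)" "t \<le> poly p (size (enc_in x))"
      by (auto simp: init_state_def)
    with R[OF that] show ?thesis by metis
  qed
  then show ?thesis unfolding poly_time_solvable_def by blast
qed


section \<open>The interviews that are needed\<close>

lemma partners_iff [simp]: "w \<in> partners S (Man m) \<longleftrightarrow> (m, w) \<in> S" "m \<in> partners S (Woman w) \<longleftrightarrow> (m, w) \<in> S"
  by simp_all

lemma partners_mono: "S \<subseteq> S' \<Longrightarrow> partners S a \<subseteq> partners S' a"
  by (cases a) auto

lemma matching_unique: "matching I \<mu> \<Longrightarrow> c \<in> partners \<mu> a \<Longrightarrow> d \<in> partners \<mu> a \<Longrightarrow> c = d"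
  unfolding matching_def by blast

lemma strict_profileD:
  assumes "strict_profile I P"
  shows "(c, c) \<notin> P a"
    and "(c, d) \<in> P a \<Longrightarrow> (d, c) \<notin> P a"
    and "c \<in> partners (acc I) a \<Longrightarrow> d \<in> partners (acc I) a \<Longrightarrow> c \<noteq> d \<Longrightarrow> (c, d) \<in> P a \<or> (d, c) \<in> P a"
    and "trans (P a)"
proof -
  from assms have P: "irrefl (P a)" "trans (P a)" "total_on (partners (acc I) a) (P a)"
    unfolding strict_profile_def strict_total_order_on_def strict_partial_order_on_def by blast+
  show "trans (P a)" by (fact P(2))
  show "(c, c) \<notin> P a" using P(1) by (rule irreflD)
  show "(c, d) \<in> P a \<Longrightarrow> (d, c) \<notin> P a" using P(1,2) by (meson irreflD transD)
  show "c \<in> partners (acc I) a \<Longrightarrow> d \<in> partners (acc I) a \<Longrightarrow> c \<noteq> d \<Longrightarrow> (c, d) \<in> P a \<or> (d, c) \<in> P a"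
    using P(3) unfolding total_on_def by blast
qed

text \<open>If \<open>a\<close> neither wants \<open>c\<close> nor fails to compare, a strict
  preference for the partner is all that is left. The converse uses uniqueness of the partner and
  asymmetry, a property that refined relations keep although they are not transitively
  closed.\<close>

lemma not_possibly_willing_iff:
  assumes "matching I \<mu>" "asym (Q a)" "c \<notin> partners \<mu> a"
  shows "\<not> possibly_willing Q \<mu> a c \<longleftrightarrow> (\<exists>d \<in> partners \<mu> a. (d, c) \<in> Q a)"
proof
  assume "\<not> possibly_willing Q \<mu> a c"
  then show "\<exists>d \<in> partners \<mu> a. (d, c) \<in> Q a"
    unfolding possibly_willing_def incomparable_def using assms(3) by auto
next
  assume "\<exists>d \<in> partners \<mu> a. (d, c) \<in> Q a"
  then obtain d where d: "d \<in> partners \<mu> a" "(d, c) \<in> Q a" by blast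
  have "(c, d) \<notin> Q a" using assms(2) d(2) by (rule asymD)
  with d matching_unique[OF assms(1) _ d(1)] show "\<not> possibly_willing Q \<mu> a c"
    unfolding possibly_willing_def incomparable_def by blast
qed

lemma super_stable_iff:
  assumes \<mu>: "matching I \<mu>" and asym: "\<And>a. asym (pref I a)"
  shows "super_stable I \<mu> \<longleftrightarrow> (\<forall>m w. (m, w) \<in> acc I - \<mu> \<longrightarrow>
    (\<exists>d. (m, d) \<in> \<mu> \<and> (d, w) \<in> pref I (Man m)) \<or> (\<exists>c. (c, w) \<in> \<mu> \<and> (c, m) \<in> pref I (Woman w)))"
proof -
  have "\<not> very_weak_blocking_pair I \<mu> m w \<longleftrightarrow> ((m, w) \<in> acc I - \<mu> \<longrightarrow>
    (\<exists>d. (m, d) \<in> \<mu> \<and> (d, w) \<in> pref I (Man m)) \<or> (\<exists>c. (c, w) \<in> \<mu> \<and> (c, m) \<in> pref I (Woman w)))" for m w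
    using not_possibly_willing_iff[of I \<mu> "pref I" "Man m" w, OF \<mu> asym]
      not_possibly_willing_iff[of I \<mu> "pref I" "Woman w" m, OF \<mu> asym]
    unfolding very_weak_blocking_pair_def by auto
  then show ?thesis unfolding super_stable_def using \<mu> by blast
qed

text \<open>An agent unwilling to switch has a partner, and totality of \<open>P\<close> turns this
  unwillingness into a strict preference for that partner.\<close>

lemma weakly_stable_strictD:
  assumes P: "strict_profile I P" and stable: "weakly_stable (I\<lparr>pref := P\<rparr>) \<mu>"
    and mw: "(m, w) \<in> acc I" "(m, w) \<notin> \<mu>"
  shows "(\<exists>d. (m, d) \<in> \<mu> \<and> (d, w) \<in> P (Man m)) \<or> (\<exists>c. (c, w) \<in> \<mu> \<and> (c, m) \<in> P (Woman w))"
proof -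
  have sub: "\<mu> \<subseteq> acc I" using stable unfolding weakly_stable_def matching_def by simp
  have *: "\<exists>d \<in> partners \<mu> a. (d, c) \<in> P a"
    if "\<not> strictly_willing P \<mu> a c" "c \<in> partners (acc I) a" "c \<notin> partners \<mu> a" for a c
  proof -
    from that(1) obtain d where "d \<in> partners \<mu> a" "(c, d) \<notin> P a"
      unfolding strictly_willing_def by blast
    with strict_profileD(3)[OF P, of d a c] that(2,3) partners_mono[OF sub, of a] show ?thesis by blast
  qed
  from stable mw have "\<not> strictly_willing P \<mu> (Man m) w \<or> \<not> strictly_willing P \<mu> (Woman w) m"
    unfolding weakly_stable_def by auto
  with *[of "Man m" w] *[of "Woman w" m] mw show ?thesis by auto
qed

text \<open>For a matching and asymmetric preferences these are the very weak blocking pairs of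
  \<open>I\<close>, by \<open>not_possibly_willing_iff\<close>.\<close>

definition unresolved :: "smpi \<Rightarrow> (nat \<times> nat) set \<Rightarrow> nat \<Rightarrow> nat \<Rightarrow> bool" where
  "unresolved I \<mu> m w \<longleftrightarrow> (m, w) \<in> acc I \<and> (m, w) \<notin> \<mu> \<and>
     \<not> (\<exists>d. (m, d) \<in> \<mu> \<and> (d, w) \<in> pref I (Man m)) \<and>
     \<not> (\<exists>c. (c, w) \<in> \<mu> \<and> (c, m) \<in> pref I (Woman w))"

text \<open>If \<open>(c, w)\<close> is unresolved, \<open>w\<close> does not prefer her partner
  \<open>m\<close> to \<open>c\<close> in \<open>I\<close>; excluding \<open>(c, m)\<close> as well
  means that she cannot compare the two. A fully known agent thus never triggers its condition on
  matched pairs.\<close>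

definition needed_interviews :: "smpi \<Rightarrow> (nat \<times> nat) set \<Rightarrow> (nat \<times> nat) set" where
  "needed_interviews I \<mu> = {(m, w). unresolved I \<mu> m w \<or> (m, w) \<in> \<mu> \<and>
     ((\<exists>c. unresolved I \<mu> c w \<and> (c, m) \<notin> pref I (Woman w)) \<or>
      (\<exists>d. unresolved I \<mu> m d \<and> (d, w) \<notin> pref I (Man m)))}"

text \<open>A strict total order on the interviewed candidates that lies inside \<open>P a\<close>
  must be the restriction of \<open>P a\<close>, so this is the only outcome of \<open>T\<close>
  compatible with \<open>P\<close>.\<close>

definition interview_refinement :: "smpi \<Rightarrow> profile \<Rightarrow> (nat \<times> nat) set \<Rightarrow> smpi" where
  "interview_refinement I P T = I\<lparr>pref := \<lambda>a. pref I a \<union> Restr (P a) (partners T a)\<rparr>"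

lemma interview_refinement_simps [simp]:
  "num (interview_refinement I P T) = num I"
  "acc (interview_refinement I P T) = acc I"
  "pref (interview_refinement I P T) a = pref I a \<union> Restr (P a) (partners T a)"
  by (simp_all add: interview_refinement_def)

lemma interview_result_refinement:
  assumes P: "strict_profile I P" "profile_refines P I" and T: "T \<subseteq> acc I"
  shows "interview_result I T (interview_refinement I P T)"
proof -
  have "strict_total_order_on (partners T a) (Restr (P a) (partners T a))" for a
    unfolding strict_total_order_on_def strict_partial_order_on_def
  proof (intro conjI)
    show "irrefl (Restr (P a) (partners T a))"
      using strict_profileD(1)[OF P(1)] by (auto simp: irrefl_def)
    show "trans (Restr (P a) (partners T a))"
      using strict_profileD(4)[OF P(1)] by (rule trans_Restr)
    show "total_on (partners T a) (Restr (P a) (partners T a))"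
      using strict_profileD(3)[OF P(1), of _ a] partners_mono[OF T, of a] by (auto simp: total_on_def)
  qed auto
  \<comment> \<open>Acyclicity is inherited from \<open>P a\<close>, which is irreflexive and its
    own transitive closure.\<close>
  moreover have "acyclic (pref I a \<union> Restr (P a) (partners T a))" for a
  proof (rule acyclic_subset)
    show "acyclic (P a)"
      using strict_profileD(1,4)[OF P(1)] by (simp add: acyclic_def)
    show "pref I a \<union> Restr (P a) (partners T a) \<subseteq> P a"
      using P(2) unfolding profile_refines_def by blast
  qed
  ultimately show ?thesis using T unfolding interview_result_def by auto
qed

section \<open>Feasibility and minimality of the needed interviews\<close>

locale min_icr_exact =
  fixes I :: smpi and P :: profile and \<mu> :: "(nat \<times> nat) set"
  assumes inst: "smpi_instance I" and strict: "strict_profile I P" and refines: "profile_refines P I"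
    and stable: "weakly_stable (I\<lparr>pref := P\<rparr>) \<mu>"
begin

lemma matching_acc: "acc J = acc I \<Longrightarrow> matching J \<mu>"
  using stable unfolding weakly_stable_def matching_def by simp

lemma mu_acc: "\<mu> \<subseteq> acc I"
  using matching_acc[of I] unfolding matching_def by simp

lemma pref_P: "(c, d) \<in> pref I a \<Longrightarrow> (c, d) \<in> P a"
  using refines unfolding profile_refines_def by blast

lemma asym_pref: "profile_refines P J \<Longrightarrow> asym (pref J a)"
  using strict_profileD(2)[OF strict, of _ _ a] unfolding profile_refines_def by (intro asymI) blast

lemma needed_interviews_acc: "needed_interviews I \<mu> \<subseteq> acc I"
  using mu_acc unfolding needed_interviews_def unresolved_def by blast

lemma refinement_feasible:
  "icr_exact_feasible (I, P, \<mu>) (interview_refinement I P (needed_interviews I \<mu>))"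
proof -
  let ?T = "needed_interviews I \<mu>"
  let ?J = "interview_refinement I P ?T"
  have J: "profile_refines P ?J"
    using pref_P unfolding profile_refines_def by auto
  have "(\<exists>d. (m, d) \<in> \<mu> \<and> (d, w) \<in> pref ?J (Man m)) \<or> (\<exists>c. (c, w) \<in> \<mu> \<and> (c, m) \<in> pref ?J (Woman w))"
    if mw: "(m, w) \<in> acc I" "(m, w) \<notin> \<mu>" for m w
  proof (cases "unresolved I \<mu> m w")
    case False
    with mw show ?thesis unfolding unresolved_def by auto
  next
    case True
    then have T: "(m, w) \<in> ?T" unfolding needed_interviews_def by blast
    from weakly_stable_strictD[OF strict stable mw] show ?thesis
    proof (elim disjE exE conjE)
      fix d assume d: "(m, d) \<in> \<mu>" "(d, w) \<in> P (Man m)"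
      \<comment> \<open>The true preference for \<open>d\<close> rules out the opposite comparison
        in \<open>I\<close>, so the matched pair \<open>(m, d)\<close> is a needed interview and
        \<open>m\<close> learns to compare \<open>d\<close> with \<open>w\<close>.\<close>
      then have "(w, d) \<notin> pref I (Man m)" using strict_profileD(2)[OF strict] pref_P by blast
      with True d(1) have "(m, d) \<in> ?T" unfolding needed_interviews_def by blast
      with T d show ?thesis by auto
    next
      fix c assume c: "(c, w) \<in> \<mu>" "(c, m) \<in> P (Woman w)"
      then have "(m, c) \<notin> pref I (Woman w)" using strict_profileD(2)[OF strict] pref_P by blast
      with True c(1) have "(c, w) \<in> ?T" unfolding needed_interviews_def by blast
      with T c show ?thesis by auto
    qed
  qed
  then have "super_stable ?J \<mu>"
    by (subst super_stable_iff[OF matching_acc asym_pref[OF J]]) auto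
  with J interview_result_refinement[OF strict refines needed_interviews_acc] show ?thesis
    unfolding icr_exact_feasible.simps interview_compatible_refinement_def by blast
qed

text \<open>Without transitive inference, a new comparison can only come from the order on the
  interviewed candidates.\<close>

lemma interview_result_newD:
  assumes "interview_result I T J" "(c, d) \<in> pref J a" "(c, d) \<notin> pref I a"
  shows "c \<in> partners T a" "d \<in> partners T a"
proof -
  from assms(1) obtain L where "strict_total_order_on (partners T a) L" "pref J a = pref I a \<union> L"
    unfolding interview_result_def by blast
  with assms(2,3) show "c \<in> partners T a" "d \<in> partners T a"
    unfolding strict_total_order_on_def strict_partial_order_on_def by blast+
qed

text \<open>Each unresolved pair must be settled by a new comparison with a partner, which requires
  interviewing both candidates. Full knowledge of one side determines who makes the comparison,
  which forces the matched pairs too.\<close>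

lemma needed_interviews_minimal:
  assumes known: "men_fully_known I \<or> women_fully_known I"
    and result: "interview_result I T J" and J: "profile_refines P J" and super: "super_stable J \<mu>"
  shows "needed_interviews I \<mu> \<subseteq> T"
proof -
  have acc: "acc J = acc I" using result unfolding interview_result_def by blast
  have range: "m < num I" "w < num I" if "(m, w) \<in> acc I" for m w
    using inst that unfolding smpi_instance_def by auto
  \<comment> \<open>A total relation contained in \<open>P a\<close> has no proper extension inside
    \<open>P a\<close>.\<close>
  have agree: "pref J a \<subseteq> pref I a" if "strict_total_order_on (partners (acc I) a) (pref I a)" for a
  proof
    fix x assume x: "x \<in> pref J a"
    obtain c d where [simp]: "x = (c, d)" by (cases x)
    have cd: "(c, d) \<in> P a" using x J unfolding profile_refines_def by auto
    then have "c \<in> partners (acc I) a" "d \<in> partners (acc I) a"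
      using strict unfolding strict_profile_def strict_total_order_on_def strict_partial_order_on_def
      by blast+
    moreover have "c \<noteq> d" "(d, c) \<notin> pref I a" using cd strict_profileD(1,2)[OF strict] pref_P by blast+
    ultimately show "x \<in> pref I a" using that unfolding strict_total_order_on_def total_on_def by auto
  qed
  have resolved: "(\<exists>d. (m, d) \<in> \<mu> \<and> (m, d) \<in> T \<and> (m, w) \<in> T \<and> (d, w) \<in> pref J (Man m) \<and> (d, w) \<notin> pref I (Man m)) \<or>
      (\<exists>c. (c, w) \<in> \<mu> \<and> (c, w) \<in> T \<and> (m, w) \<in> T \<and> (c, m) \<in> pref J (Woman w) \<and> (c, m) \<notin> pref I (Woman w))"
    if "unresolved I \<mu> m w" for m w
  proof -
    from that super[unfolded super_stable_iff[OF matching_acc[OF acc] asym_pref[OF J]]]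
    have "(\<exists>d. (m, d) \<in> \<mu> \<and> (d, w) \<in> pref J (Man m)) \<or> (\<exists>c. (c, w) \<in> \<mu> \<and> (c, m) \<in> pref J (Woman w))"
      unfolding unresolved_def acc by blast
    then show ?thesis
    proof (elim disjE exE conjE)
      fix d assume d: "(m, d) \<in> \<mu>" "(d, w) \<in> pref J (Man m)"
      with that have "(d, w) \<notin> pref I (Man m)" unfolding unresolved_def by blast
      with d interview_result_newD[OF result d(2)] show ?thesis by auto
    next
      fix c assume c: "(c, w) \<in> \<mu>" "(c, m) \<in> pref J (Woman w)"
      with that have "(c, m) \<notin> pref I (Woman w)" unfolding unresolved_def by blast
      with c interview_result_newD[OF result c(2)] show ?thesis by auto
    qed
  qed
  \<comment> \<open>Since \<open>w\<close> cannot compare \<open>c\<close> and \<open>m\<close>, the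
    known side must be the men. Then \<open>c\<close> gains no comparison, so \<open>w\<close>
    settles \<open>(c, w)\<close> by interviewing her partner, who is \<open>m\<close> by
    uniqueness.\<close>
  have woman: "(m, w) \<in> T"
    if mw: "(m, w) \<in> \<mu>" and c: "unresolved I \<mu> c w" and new: "(c, m) \<notin> pref I (Woman w)" for m w c
  proof -
    have cw: "(c, w) \<in> acc I" "c \<noteq> m" "(m, c) \<notin> pref I (Woman w)"
      using c mw unfolding unresolved_def by blast+
    have mw': "(m, w) \<in> acc I" using mw mu_acc by blast
    have "\<not> women_fully_known I"
    proof
      assume "women_fully_known I"
      then have "total_on (partners (acc I) (Woman w)) (pref I (Woman w))"
        using range[OF cw(1)] unfolding women_fully_known_def strict_total_order_on_def by blast
      with cw mw' new show False unfolding total_on_def by auto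
    qed
    with known have "men_fully_known I" by blast
    then have "pref J (Man c) \<subseteq> pref I (Man c)"
      using range[OF cw(1)] unfolding men_fully_known_def by (intro agree) blast
    with resolved[OF c] obtain b where b: "(b, w) \<in> \<mu>" "(b, w) \<in> T" by blast
    with mw matching_unique[OF matching_acc[of I], of b "Woman w" m] show ?thesis by auto
  qed
  have man: "(m, w) \<in> T"
    if mw: "(m, w) \<in> \<mu>" and d: "unresolved I \<mu> m d" and new: "(d, w) \<notin> pref I (Man m)" for m w d
  proof -
    have md: "(m, d) \<in> acc I" "d \<noteq> w" "(w, d) \<notin> pref I (Man m)"
      using d mw unfolding unresolved_def by blast+
    have mw': "(m, w) \<in> acc I" using mw mu_acc by blast
    have "\<not> men_fully_known I"
    proof
      assume "men_fully_known I"
      then have "total_on (partners (acc I) (Man m)) (pref I (Man m))"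
        using range[OF md(1)] unfolding men_fully_known_def strict_total_order_on_def by blast
      with md mw' new show False unfolding total_on_def by auto
    qed
    with known have "women_fully_known I" by blast
    then have "pref J (Woman d) \<subseteq> pref I (Woman d)"
      using range[OF md(1)] unfolding women_fully_known_def by (intro agree) blast
    with resolved[OF d] obtain b where b: "(m, b) \<in> \<mu>" "(m, b) \<in> T" by blast
    with mw matching_unique[OF matching_acc[of I], of b "Man m" w] show ?thesis by auto
  qed
  show ?thesis
  proof (intro subrelI)
    fix m w assume "(m, w) \<in> needed_interviews I \<mu>"
    then have "unresolved I \<mu> m w \<or> (m, w) \<in> \<mu> \<and>
       ((\<exists>c. unresolved I \<mu> c w \<and> (c, m) \<notin> pref I (Woman w)) \<or>
        (\<exists>d. unresolved I \<mu> m d \<and> (d, w) \<notin> pref I (Man m)))"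
      by (simp add: needed_interviews_def)
    then show "(m, w) \<in> T"
      by (elim disjE conjE exE) (use resolved[of m w] in blast, fact woman, fact man)
  qed
qed

text \<open>The cost of a feasible \<open>J\<close> is attained by some interview set
  \<open>S\<close>, and minimality by inclusion in every such set gives minimality of the
  cardinality.\<close>

lemma refinement_solution:
  assumes known: "men_fully_known I \<or> women_fully_known I"
  shows "min_icr_exact_solution (I, P, \<mu>) (interview_refinement I P (needed_interviews I \<mu>))"
proof -
  let ?T = "needed_interviews I \<mu>"
  let ?J = "interview_refinement I P ?T"
  have "interview_cost I ?J \<le> interview_cost I J" if J: "icr_exact_feasible (I, P, \<mu>) J" for J
  proof -
    from J obtain T where "interview_result I T J"
      unfolding icr_exact_feasible.simps interview_compatible_refinement_def by blast
    then have "\<exists>k T. interview_result I T J \<and> card T = k" by blast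
    from LeastI_ex[OF this] have "\<exists>T. interview_result I T J \<and> card T = interview_cost I J"
      unfolding interview_cost_def .
    then obtain S where S: "interview_result I S J" "card S = interview_cost I J" by blast
    have "?T \<subseteq> S" using needed_interviews_minimal[OF known S(1)] J by simp
    moreover have "S \<subseteq> {..<num I} \<times> {..<num I}"
      using S(1) inst unfolding interview_result_def smpi_instance_def by blast
    then have "finite S" by (rule finite_subset) simp
    ultimately have "card ?T \<le> interview_cost I J" using card_mono S(2) by metis
    moreover have "interview_cost I ?J \<le> card ?T"
      unfolding interview_cost_def
      using interview_result_refinement[OF strict refines needed_interviews_acc]
      by (intro Least_le) blast
    ultimately show ?thesis by simp
  qed
  with refinement_feasible show ?thesis by simp
qed

end


section \<open>Computing the refinement\<close>

definition entry :: "val \<Rightarrow> nat \<Rightarrow> nat \<Rightarrow> bool" where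
  "entry v i j \<longleftrightarrow> nth_val (nth_val v i) j \<noteq> Atom"

lemma poly_time_pred_entry:
  "poly_time f \<Longrightarrow> poly_time g \<Longrightarrow> poly_time h \<Longrightarrow> poly_time_pred (\<lambda>v. entry (f v) (len (g v)) (len (h v)))"
  unfolding entry_def by (intro poly_time_pred_noteq_Atom poly_time_nth_val)

lemma entry_enc_rel [simp]: "i < n \<Longrightarrow> j < n \<Longrightarrow> entry (enc_rel n r) i j \<longleftrightarrow> (i, j) \<in> r"
  by (simp add: entry_def enc_rel_def)

lemma enc_list_eq_enc_rel:
  assumes "\<And>i j. i < n \<Longrightarrow> j < n \<Longrightarrow> b i j \<longleftrightarrow> (i, j) \<in> r"
  shows "enc_list (\<lambda>i. enc_list (\<lambda>j. enc_bool (b i j)) [0..<n]) [0..<n] = enc_rel n r"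
  using assms by (auto simp: enc_rel_def enc_list_eq_iff)

text \<open>The components of \<open>enc_input (I, P, \<mu>)\<close>.\<close>

definition "in_acc v = hd_val (hd_val v)"
definition "in_pref_men v = hd_val (tl_val (hd_val v))"
definition "in_pref_women v = tl_val (tl_val (hd_val v))"
definition "in_true_men v = hd_val (hd_val (tl_val v))"
definition "in_true_women v = tl_val (hd_val (tl_val v))"
definition "in_matching v = tl_val (tl_val v)"

lemmas in_defs = in_acc_def in_pref_men_def in_pref_women_def in_true_men_def in_true_women_def
  in_matching_def

text \<open>The bound \<open>len (in_acc v)\<close> is the number of rows of the acceptability
  matrix, which is \<open>n\<close> on codes of inputs.\<close>

definition unresolved_val :: "val \<Rightarrow> nat \<Rightarrow> nat \<Rightarrow> bool" where
  "unresolved_val v m w \<longleftrightarrow> entry (in_acc v) m w \<and> \<not> entry (in_matching v) m w \<and>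
     \<not> (\<exists>d < len (in_acc v). entry (in_matching v) m d \<and> entry (nth_val (in_pref_men v) m) d w) \<and>
     \<not> (\<exists>c < len (in_acc v). entry (in_matching v) c w \<and> entry (nth_val (in_pref_women v) w) c m)"

definition needed_val :: "val \<Rightarrow> nat \<Rightarrow> nat \<Rightarrow> bool" where
  "needed_val v m w \<longleftrightarrow> unresolved_val v m w \<or> entry (in_matching v) m w \<and>
     ((\<exists>c < len (in_acc v). unresolved_val v c w \<and> \<not> entry (nth_val (in_pref_women v) w) c m) \<or>
      (\<exists>d < len (in_acc v). unresolved_val v m d \<and> \<not> entry (nth_val (in_pref_men v) m) d w))"

definition refinement_val :: "val \<Rightarrow> val" where
  "refinement_val v = Pair (in_acc v) (Pair
     (enc_list (\<lambda>m. enc_list (\<lambda>c. enc_list (\<lambda>d. enc_bool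
        (entry (nth_val (in_pref_men v) m) c d \<or>
         entry (nth_val (in_true_men v) m) c d \<and> needed_val v m c \<and> needed_val v m d))
        [0..<len (in_acc v)]) [0..<len (in_acc v)]) [0..<len (in_acc v)])
     (enc_list (\<lambda>w. enc_list (\<lambda>c. enc_list (\<lambda>d. enc_bool
        (entry (nth_val (in_pref_women v) w) c d \<or>
         entry (nth_val (in_true_women v) w) c d \<and> needed_val v c w \<and> needed_val v d w))
        [0..<len (in_acc v)]) [0..<len (in_acc v)]) [0..<len (in_acc v)]))"

lemmas poly_time_intros = poly_time_id poly_time_hd poly_time_tl poly_time_Pair poly_time_nth_val
  poly_time_enc_list poly_time_enc_bool poly_time_pred_entry poly_time_pred_not poly_time_pred_conj
  poly_time_pred_disj poly_time_pred_ex

text \<open>Arbitrary \<open>f\<close>, \<open>g\<close>, \<open>h\<close> are allowed because under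
  quantifiers and list constructors the input and the indices become projections of nested
  pairs.\<close>

lemma poly_time_pred_unresolved:
  assumes "poly_time f" "poly_time g" "poly_time h"
  shows "poly_time_pred (\<lambda>v. unresolved_val (f v) (len (g v)) (len (h v)))"
  unfolding unresolved_val_def in_defs
  by (intro poly_time_intros assms assms[THEN poly_time_comp])

lemma poly_time_pred_needed:
  assumes "poly_time f" "poly_time g" "poly_time h"
  shows "poly_time_pred (\<lambda>v. needed_val (f v) (len (g v)) (len (h v)))"
  unfolding needed_val_def in_defs
  by (intro poly_time_intros poly_time_pred_unresolved assms assms[THEN poly_time_comp])

lemma poly_time_refinement: "poly_time refinement_val"
  unfolding refinement_val_def in_defs
  by (intro poly_time_intros poly_time_pred_needed)

section \<open>Correctness of the computed refinement on codes of inputs\<close>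

context min_icr_exact
begin

abbreviation "code \<equiv> enc_input (I, P, \<mu>)"

lemma in_code:
  "in_acc code = enc_rel (num I) (acc I)"
  "in_pref_men code = enc_list (\<lambda>m. enc_rel (num I) (pref I (Man m))) [0..<num I]"
  "in_pref_women code = enc_list (\<lambda>w. enc_rel (num I) (pref I (Woman w))) [0..<num I]"
  "in_true_men code = enc_list (\<lambda>m. enc_rel (num I) (P (Man m))) [0..<num I]"
  "in_true_women code = enc_list (\<lambda>w. enc_rel (num I) (P (Woman w))) [0..<num I]"
  "in_matching code = enc_rel (num I) \<mu>"
  by (simp_all add: in_defs enc_smpi_def enc_profile_def)

lemma len_acc: "len (enc_rel (num I) (acc I)) = num I"
  by (simp add: enc_rel_def)

lemma acc_less: "(m, w) \<in> acc I \<Longrightarrow> m < num I \<and> w < num I"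
  using inst unfolding smpi_instance_def by auto

lemma mu_less: "(m, w) \<in> \<mu> \<Longrightarrow> m < num I \<and> w < num I"
  using acc_less mu_acc by blast

text \<open>Bounding the quantifiers by \<open>n\<close> loses nothing, since witnesses occur in
  pairs of the matching and hence are below \<open>n\<close>.\<close>

lemma unresolved_val_code:
  assumes "m < num I" "w < num I"
  shows "unresolved_val code m w \<longleftrightarrow> unresolved I \<mu> m w"
  using assms mu_less unfolding unresolved_val_def unresolved_def in_code len_acc
  by (auto simp del: enc_input.simps)

lemma unresolved_less: "unresolved I \<mu> m w \<Longrightarrow> m < num I \<and> w < num I"
  using acc_less unfolding unresolved_def by blast

lemma needed_val_code:
  assumes "m < num I" "w < num I"
  shows "needed_val code m w \<longleftrightarrow> (m, w) \<in> needed_interviews I \<mu>"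
proof -
  \<comment> \<open>Unresolved pairs are acceptable, so every witness \<open>c\<close> of the
    unbounded statement is below \<open>num I\<close>.\<close>
  have "(\<exists>c < num I. unresolved_val code c w \<and> \<not> entry (nth_val (in_pref_women code) w) c m)
      \<longleftrightarrow> (\<exists>c. unresolved I \<mu> c w \<and> (c, m) \<notin> pref I (Woman w))"
    using assms unresolved_less unfolding in_code
    by (simp add: unresolved_val_code del: enc_input.simps cong: conj_cong) blast
  moreover have "(\<exists>d < num I. unresolved_val code m d \<and> \<not> entry (nth_val (in_pref_men code) m) d w)
      \<longleftrightarrow> (\<exists>d. unresolved I \<mu> m d \<and> (d, w) \<notin> pref I (Man m))"
    using assms unresolved_less unfolding in_code
    by (simp add: unresolved_val_code del: enc_input.simps cong: conj_cong) blast
  moreover have "len (in_acc code) = num I" "entry (in_matching code) m w \<longleftrightarrow> (m, w) \<in> \<mu>"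
    using assms by (simp_all only: in_code len_acc entry_enc_rel)
  ultimately show ?thesis
    unfolding needed_val_def needed_interviews_def by (simp add: unresolved_val_code assms del: enc_input.simps)
qed

lemma refinement_val_code:
  "refinement_val code = enc_smpi (interview_refinement I P (needed_interviews I \<mu>))"
proof -
  let ?J = "interview_refinement I P (needed_interviews I \<mu>)"
  have men: "enc_list (\<lambda>c. enc_list (\<lambda>d. enc_bool
        (entry (nth_val (in_pref_men code) m) c d \<or>
         entry (nth_val (in_true_men code) m) c d \<and> needed_val code m c \<and> needed_val code m d))
        [0..<num I]) [0..<num I] = enc_rel (num I) (pref ?J (Man m))" if "m < num I" for m
    using that by (intro enc_list_eq_enc_rel) (auto simp: in_code needed_val_code simp del: enc_input.simps)
  have women: "enc_list (\<lambda>c. enc_list (\<lambda>d. enc_bool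
        (entry (nth_val (in_pref_women code) w) c d \<or>
         entry (nth_val (in_true_women code) w) c d \<and> needed_val code c w \<and> needed_val code d w))
        [0..<num I]) [0..<num I] = enc_rel (num I) (pref ?J (Woman w))" if "w < num I" for w
    using that by (intro enc_list_eq_enc_rel) (auto simp: in_code needed_val_code simp del: enc_input.simps)
  have n: "len (in_acc code) = num I" by (simp only: in_code len_acc)
  show ?thesis
    using men women unfolding refinement_val_def enc_smpi_def enc_profile_def n in_code(1)
    by (simp add: enc_list_eq_iff len_acc del: enc_input.simps interview_refinement_simps(3))
qed

end

theorem theorem17:
  shows "poly_time_solvable enc_input enc_smpi
           {x. min_icr_exact_input x \<and> one_side_fully_known x}
           min_icr_exact_solution"
proof (rule poly_time_solvableI[OF poly_time_refinement])
  fix x assume x: "x \<in> {x. min_icr_exact_input x \<and> one_side_fully_known x}"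
  obtain I P \<mu> where [simp]: "x = (I, P, \<mu>)" by (cases x)
  from x interpret min_icr_exact I P \<mu> by unfold_locales auto
  show "\<exists>y. refinement_val (enc_input x) = enc_smpi y \<and> min_icr_exact_solution x y"
    using refinement_val_code refinement_solution x by auto
qed

end
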